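(* Let $n$ be a positive even integer, and let $a_1,\ldots,a_n\in\mathbb{Z}$ with $\sum_{k=1}^n a_k\equiv 0 \pmod n$. Then there exists a permutation $\sigma$ of $\{1,\ldots,n\}$ such that $$\sum_{k=1}^n k\,a_{\sigma(k)}\equiv 0 \pmod{n/2}.$$ Consequently, if $w_1,\ldots,w_n\in\mathbb{Z}$ form an arithmetic progression with even common difference, then there exists a permutation $\sigma$ of $\{1,\ldots,n\}$ such that $\sum_{k=1}^n w_k a_{\sigma(k)}\equiv 0 \pmod n$. *)

theory Defs
  imports "HOL-Number_Theory.Cong" "HOL-Combinatorics.Permutations"
begin

end

theory Submission
  imports Defs
begin

text \<open>
  Only weights modulo \<open>m = n/2\<close> matter, and each residue occurs twice among \<open>1..n\<close>. One shows, by
  induction over the prime factors of \<open>m\<close>, that \<open>2m\<close> integers whose sum is divisible by \<open>m\<close> can be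
  given the weights \<open>0..<2m\<close> so that the weighted sum is divisible by \<open>m\<close>.

  For \<open>m = p\<close> prime, sort the integers by residue. Either some residue is taken at least \<open>p\<close> times, and
  moving one exceptional element through a full set of weights reaches every residue, or the integers
  split into \<open>p\<close> pairs with distinct residues; swapping the two members of a pair with
  adjacent weights changes the weighted sum by a nonzero amount, and the subset sums of \<open>p\<close> nonzero
  residues cover everything. The same dichotomy gives the Erdos-Ginzburg-Ziv theorem for \<open>p\<close>.

  For \<open>m = p q\<close>, split the integers into \<open>2q\<close> groups of size \<open>p\<close> with sums divisible by \<open>p\<close>, and label the
  groups by the result for \<open>q\<close>. Groups whose labels agree modulo \<open>q\<close> are merged into \<open>q\<close> groups of
  size \<open>2p\<close>, to each of which the prime case applies.
\<close>

section \<open>Subset sums of nonzero residues modulo a prime\<close>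

text \<open>Since \<open>d\<close> is invertible modulo \<open>p\<close>, its multiples added to a
  single element of \<open>R\<close> already run through all residues.\<close>

lemma residue_set_closed_under_shift:
  fixes p :: nat and d :: int
  assumes p: "prime p" and R: "R \<subseteq> {0..<int p}" "R \<noteq> {}" and d: "\<not> int p dvd d"
    and cl: "\<And>r. r \<in> R \<Longrightarrow> (r + d) mod int p \<in> R"
  shows "R = {0..<int p}"
proof
  obtain r where r: "r \<in> R" using R by auto
  have step: "(r + int k * d) mod int p \<in> R" for k
  proof (induction k)
    case 0
    have "r mod int p = r" using r R(1) by auto
    then show ?case using r by simp
  next
    case (Suc k)
    from cl[OF this] show ?case by (simp add: mod_simps algebra_simps)
  qed
  have "coprime d (int p)"
    using p d by (metis coprime_commute prime_imp_coprime prime_nat_int_transfer)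
  then obtain e where e: "[d * e = 1] (mod int p)" using cong_solve_coprime_int by blast
  have p0: "int p > 0" using p by (simp add: prime_gt_0_nat)
  show "{0..<int p} \<subseteq> R"
  proof
    fix t assume t: "t \<in> {0..<int p}"
    define k where "k = nat ((e * (t - r)) mod int p)"
    have "int k = (e * (t - r)) mod int p" using p0 by (simp add: k_def)
    then have "[int k = e * (t - r)] (mod int p)" by (simp add: cong_def)
    then have "[r + int k * d = r + e * (t - r) * d] (mod int p)"
      by (intro cong_add cong_mult cong_refl)
    also have "r + e * (t - r) * d = r + (d * e) * (t - r)" by (simp add: algebra_simps)
    also have "[\<dots> = r + 1 * (t - r)] (mod int p)" by (intro cong_add cong_mult cong_refl e)
    finally have "(r + int k * d) mod int p = t" using t by (simp add: cong_def)
    then show "t \<in> R" using step[of k] by simp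
  qed
qed (rule R)

text \<open>An easy case of Cauchy-Davenport: admitting a further index either yields a new residue
  or leaves the set of sums closed under a nonzero shift, and then it is already everything.\<close>

lemma card_subset_sums_ge:
  fixes p :: nat and d :: "'a \<Rightarrow> int"
  assumes p: "prime p" and "finite F" and "\<And>i. i \<in> F \<Longrightarrow> \<not> int p dvd d i"
  shows "min p (card F + 1) \<le> card ((\<lambda>E. sum d E mod int p) ` Pow F)"
  using assms(2,3)
proof (induction F rule: finite_induct)
  case empty
  then show ?case using prime_gt_0_nat[OF p] by simp
next
  case (insert i F)
  have p0: "int p > 0" using p by (simp add: prime_gt_0_nat)
  define R where "R = (\<lambda>E. sum d E mod int p) ` Pow F"
  define R' where "R' = (\<lambda>E. sum d E mod int p) ` Pow (insert i F)"
  have RR': "R \<subseteq> R'" unfolding R_def R'_def by auto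
  have shift: "(r + d i) mod int p \<in> R'" if "r \<in> R" for r
  proof -
    from that obtain E where E: "E \<subseteq> F" "r = sum d E mod int p" unfolding R_def by auto
    have "finite E" "i \<notin> E" using E insert by (auto intro: finite_subset)
    then have "(r + d i) mod int p = sum d (insert i E) mod int p"
      using E by (simp add: mod_simps algebra_simps)
    then show ?thesis unfolding R'_def using E by blast
  qed
  have R_sub: "R \<subseteq> {0..<int p}" unfolding R_def using p0 by auto
  have finR': "finite R'" unfolding R'_def using insert by simp
  have IH: "min p (card F + 1) \<le> card R" unfolding R_def using insert by simp
  show ?case
  proof (cases "R' = R")
    case True
    have "R = {0..<int p}"
      by (rule residue_set_closed_under_shift[OF p R_sub, of "d i"])
        (use insert shift True in \<open>auto simp: R_def\<close>)
    then have "card R' = p" using True by simp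
    then show ?thesis unfolding R'_def by simp
  next
    case False
    then have "card R < card R'" using RR' finR' by (intro psubset_card_mono) auto
    then show ?thesis using IH insert unfolding R'_def by simp
  qed
qed

lemma subset_sum_cong:
  fixes p :: nat and d :: "'a \<Rightarrow> int"
  assumes p: "prime p" and F: "finite F" "p - 1 \<le> card F" "\<And>i. i \<in> F \<Longrightarrow> \<not> int p dvd d i"
  obtains E where "E \<subseteq> F" "[sum d E = t] (mod int p)"
proof -
  define R where "R = (\<lambda>E. sum d E mod int p) ` Pow F"
  have p0: "int p > 0" using p by (simp add: prime_gt_0_nat)
  have "p \<le> card R" using card_subset_sums_ge[OF p F(1,3)] F(2) unfolding R_def by simp
  moreover have sub: "R \<subseteq> {0..<int p}" unfolding R_def using p0 by auto
  ultimately have "R = {0..<int p}" by (intro card_seteq) auto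
  then have "t mod int p \<in> R" using p0 by simp
  then show ?thesis using that unfolding R_def cong_def by auto
qed

text \<open>Sort by \<open>f\<close> and compare positions \<open>i\<close> and
  \<open>i + p\<close>. One equality makes \<open>f\<close> constant on the window in between; if
  there is none, the sorted enumeration itself serves as \<open>e\<close>. Both results for a prime
  modulus split along these two cases.\<close>

lemma constant_class_or_distinct_pairs:
  fixes f :: "'a \<Rightarrow> 'b::linorder"
  assumes "finite I" "card I = 2 * p"
  obtains (constant_on) C c where "C \<subseteq> I" "card C = p" "\<And>x. x \<in> C \<Longrightarrow> f x = c"
  | (pairs) e where "bij_betw e {..<2*p} I" "\<And>i. i < p \<Longrightarrow> f (e i) \<noteq> f (e (i + p))"
proof -
  obtain ys where ys: "set ys = I" "distinct ys"
    using finite_distinct_list[OF assms(1)] by blast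
  define xs where "xs = sort_key f ys"
  have xs: "set xs = I" "distinct xs" "sorted (map f xs)"
    unfolding xs_def using ys by simp_all
  have len: "length xs = 2 * p" using distinct_card[OF xs(2)] xs(1) assms(2) by simp
  have e: "bij_betw ((!) xs) {..<2*p} I" by (rule bij_betw_nth) (simp_all add: xs len)
  show thesis
  proof (cases "\<exists>i<p. f (xs ! i) = f (xs ! (i + p))")
    case False
    then show thesis using pairs[OF e] by blast
  next
    case True
    then obtain i where i: "i < p" "f (xs ! i) = f (xs ! (i + p))" by blast
    have mono: "f (xs ! j) \<le> f (xs ! k)" if "j \<le> k" "k < 2 * p" for j k
      using sorted_nth_mono[OF xs(3) that(1)] that len by simp
    show thesis
    proof (rule constant_on)
      show "(!) xs ` {i..<i+p} \<subseteq> I" using i len xs(1) by auto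
      show "card ((!) xs ` {i..<i+p}) = p"
        using inj_on_nth[OF xs(2), of "{i..<i+p}"] i len by (simp add: card_image)
      show "f x = f (xs ! i)" if "x \<in> (!) xs ` {i..<i+p}" for x
      proof -
        from that obtain j where j: "i \<le> j" "j < i + p" "x = xs ! j" by auto
        have "f (xs ! i) \<le> f x" "f x \<le> f (xs ! (i + p))"
          using mono[of i j] mono[of j "i + p"] i j by simp_all
        then show ?thesis using i(2) by simp
      qed
    qed
  qed
qed

section \<open>Zero-sum blocks modulo a prime\<close>

text \<open>In the case of pairs, take one member of each; switching to the other member changes the
  sum by a nonzero residue, so subset sums of these changes can cancel the initial sum.\<close>

lemma Erdos_Ginzburg_Ziv_prime:
  fixes p :: nat and a :: "'a \<Rightarrow> int"
  assumes p: "prime p" and "finite I" "card I = 2 * p"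
  obtains J where "J \<subseteq> I" "card J = p" "int p dvd sum a J"
proof (rule constant_class_or_distinct_pairs[OF assms(2,3), of "\<lambda>x. a x mod int p"])
  fix C c assume C: "C \<subseteq> I" "card C = p" "\<And>x. x \<in> C \<Longrightarrow> a x mod int p = c"
  have "sum a C mod int p = (\<Sum>x\<in>C. a x mod int p) mod int p" by (simp add: mod_sum_eq)
  also have "(\<Sum>x\<in>C. a x mod int p) = int p * c" using C by simp
  finally show thesis using that C by (simp add: dvd_eq_mod_eq_0)
next
  fix e assume e: "bij_betw e {..<2*p} I"
    and ne: "\<And>i. i < p \<Longrightarrow> a (e i) mod int p \<noteq> a (e (i + p)) mod int p"
  have inj: "inj_on e {..<2*p}" using e by (simp add: bij_betw_def)
  define d where "d i = a (e (i + p)) - a (e i)" for i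
  obtain E where E: "E \<subseteq> {..<p}" "[sum d E = - (\<Sum>i<p. a (e i))] (mod int p)"
    by (rule subset_sum_cong[OF p, of "{..<p}" d])
      (use ne in \<open>auto simp: d_def mod_eq_dvd_iff dvd_diff_commute\<close>)
  define h where "h i = (if i \<in> E then i + p else i)" for i
  have h: "inj_on h {..<p}" "h ` {..<p} \<subseteq> {..<2*p}" by (auto simp: h_def inj_on_def)
  have eh: "inj_on (e \<circ> h) {..<p}" using h inj by (meson comp_inj_on inj_on_subset)
  show thesis
  proof (rule that)
    show "(e \<circ> h) ` {..<p} \<subseteq> I" using h e by (auto simp: bij_betw_def)
    show "card ((e \<circ> h) ` {..<p}) = p" using card_image[OF eh] by simp
    have "sum a ((e \<circ> h) ` {..<p}) = (\<Sum>i<p. a (e (h i)))"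
      using sum.reindex[OF eh, of a] by (simp add: o_def)
    also have "\<dots> = (\<Sum>i<p. a (e i) + (if i \<in> E then d i else 0))"
      by (intro sum.cong) (auto simp: h_def d_def)
    also have "\<dots> = (\<Sum>i<p. a (e i)) + sum d E"
      using E(1) by (simp add: sum.distrib sum.If_cases Int_absorb1)
    finally show "int p dvd sum a ((e \<circ> h) ` {..<p})"
      using E(2) by (simp add: cong_iff_dvd_diff algebra_simps)
  qed
qed

text \<open>Blocks are split off while at least \<open>2 * p\<close> elements remain; the last block
  of \<open>p\<close> elements inherits divisibility from the total sum.\<close>

lemma zero_sum_partition:
  fixes p :: nat and a :: "'a \<Rightarrow> int"
  assumes p: "prime p" and "finite I" "card I = p * N" "int p dvd sum a I"
  shows "\<exists>g. g ` I \<subseteq> {..<N} \<and> (\<forall>j<N. card {x \<in> I. g x = j} = p \<and> int p dvd sum a {x \<in> I. g x = j})"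
  using assms(2-)
proof (induction N arbitrary: I)
  case 0
  then show ?case by simp
next
  case (Suc N)
  obtain J where J: "J \<subseteq> I" "card J = p" "int p dvd sum a J"
  proof (cases "N = 0")
    case True
    then show thesis using that[of I] Suc.prems by simp
  next
    case False
    then have "2 * p \<le> card I" using Suc.prems by simp
    then obtain K where K: "K \<subseteq> I" "card K = 2 * p" "finite K"
      using Suc.prems(1) by (metis obtain_subset_with_card_n)
    show thesis by (rule Erdos_Ginzburg_Ziv_prime[OF p K(3,2), of a]) (use that K in blast)
  qed
  have "card (I - J) = p * N" using J Suc.prems by (simp add: card_Diff_subset finite_subset)
  moreover have "int p dvd sum a (I - J)" using J Suc.prems by (simp add: sum_diff)
  ultimately obtain g where g: "g ` (I - J) \<subseteq> {..<N}"
    "\<And>j. j < N \<Longrightarrow> card {x \<in> I - J. g x = j} = p \<and> int p dvd sum a {x \<in> I - J. g x = j}"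
    using Suc.IH[of "I - J"] Suc.prems(1) by blast
  define g' where "g' x = (if x \<in> J then N else g x)" for x
  have 1: "{x \<in> I. g' x = j} = {x \<in> I - J. g x = j}" if "j < N" for j
    using that by (auto simp: g'_def)
  have 2: "{x \<in> I. g' x = N} = J" using J(1) g(1) by (auto simp: g'_def)
  have "g' ` I \<subseteq> {..<Suc N}" using g(1) by (force simp: g'_def)
  moreover have "card {x \<in> I. g' x = j} = p \<and> int p dvd sum a {x \<in> I. g' x = j}" if "j < Suc N" for j
    using that J g(2) 1 2 by (cases "j = N") (simp_all add: less_Suc_eq)
  ultimately show ?case by blast
qed

section \<open>Weightings modulo a prime\<close>

lemma prime_weighting:
  fixes p :: nat and a :: "'a \<Rightarrow> int"
  assumes p: "prime p" and I: "finite I" "card I = 2 * p"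
  shows "\<exists>w. bij_betw w I {..<2*p} \<and> int p dvd (\<Sum>x\<in>I. int (w x) * a x)"
proof (rule constant_class_or_distinct_pairs[OF I, of "\<lambda>x. a x mod int p"])
  have p0: "p > 0" using p by (simp add: prime_gt_0_nat)
  fix C c assume C: "C \<subseteq> I" "card C = p" "\<And>x. x \<in> C \<Longrightarrow> a x mod int p = c"
  have finC: "finite C" using C I finite_subset by blast
  show ?thesis
  proof (cases "\<forall>x\<in>I. a x mod int p = c")
    \<comment> \<open>With all residues equal to \<open>c\<close>, any weighting works, as the
      weights add up to \<open>p * (2 * p - 1)\<close>.\<close>
    case True
    obtain w where w: "bij_betw w I {..<2*p}" using I by (metis ex_bij_betw_finite_nat atLeast0LessThan)
    have "[(\<Sum>x\<in>I. int (w x) * a x) = (\<Sum>x\<in>I. int (w x) * c)] (mod int p)"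
      by (intro cong_sum cong_mult cong_refl) (use True in \<open>auto simp: cong_def\<close>)
    also have "(\<Sum>x\<in>I. int (w x) * c) = (\<Sum>k<2*p. int k * c)"
      by (rule sum.reindex_bij_betw[OF w, of "\<lambda>k. int k * c"])
    also have "\<dots> = int p * (2 * int p - 1) * c"
    proof -
      have "2 * (\<Sum>k<q. int k) = int q * (int q - 1)" for q
        by (induction q) (auto simp: algebra_simps)
      from this[of "2 * p"] show ?thesis by (simp flip: sum_distrib_right)
    qed
    finally show ?thesis using w by (auto simp: cong_dvd_iff)
  next
    case False
    then obtain b where b: "b \<in> I" "a b mod int p \<noteq> c" by blast
    \<comment> \<open>Only \<open>p - 1\<close> elements of \<open>C\<close> are kept, so that
      together with \<open>b\<close> they fill the weights \<open>0..<p\<close>. The rest,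
      \<open>K\<close>, takes \<open>p..<2*p\<close> in any order.\<close>
    obtain D where D: "D \<subseteq> C" "card D = p - 1" "finite D"
      using C(2) finC by (metis diff_le_self obtain_subset_with_card_n)
    have bD: "b \<notin> D" using b C D by blast
    define K where "K = I - insert b D"
    have "card K = p"
      unfolding K_def using D bD b C I p0
      by (subst card_Diff_subset) auto
    moreover have "finite K" using I by (simp add: K_def)
    ultimately obtain v where v: "bij_betw v K {p..<2*p}"
      using finite_same_card_bij[of K "{p..<2*p}"] by auto
    \<comment> \<open>\<open>S\<close> is the weighted sum modulo \<open>p\<close> that would result
      if \<open>a b\<close> were replaced by \<open>c\<close>. Giving \<open>b\<close> the weight
      \<open>r\<close> corrects it by \<open>r * (a b - c)\<close>.\<close>
    define S where "S = c * (\<Sum>k<p. int k) + (\<Sum>x\<in>K. int (v x) * a x)"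
    have "\<not> int p dvd a b - c"
    proof
      assume "int p dvd a b - c"
      \<comment> \<open>An element of \<open>C\<close> is needed to see that \<open>c\<close> is a
        reduced residue.\<close>
      moreover obtain x where "x \<in> C" using C(2) p0 by fastforce
      then have "c mod int p = c" using C(3) by force
      ultimately show False using b(2) by (metis mod_eq_dvd_iff)
    qed
    then have "coprime (a b - c) (int p)"
      using p by (metis coprime_commute prime_imp_coprime prime_nat_int_transfer)
    then obtain e where e: "[(a b - c) * e = 1] (mod int p)" using cong_solve_coprime_int by blast
    \<comment> \<open>The solution of \<open>r * (a b - c) = - S\<close> modulo \<open>p\<close>,
      reduced below \<open>p\<close> to be a legitimate weight.\<close>
    define r where "r = nat ((e * (- S)) mod int p)"
    have r: "int r = (e * (- S)) mod int p" using p0 by (simp add: r_def)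
    then have rp: "r < p" using p0 by (metis of_nat_0_less_iff of_nat_less_iff pos_mod_bound)
    have "[int r * (a b - c) = e * (- S) * (a b - c)] (mod int p)"
      by (intro cong_mult cong_refl) (simp add: r cong_def)
    also have "e * (- S) * (a b - c) = ((a b - c) * e) * (- S)" by (simp add: algebra_simps)
    also have "[\<dots> = 1 * (- S)] (mod int p)" by (intro cong_mult cong_refl e)
    finally have rS: "[int r * (a b - c) = - S] (mod int p)" by simp
    have "card ({..<p} - {r}) = p - 1" using rp by simp
    then obtain u where u: "bij_betw u D ({..<p} - {r})"
      using finite_same_card_bij[of D "{..<p} - {r}"] D by auto
    define w where "w x = (if x = b then r else if x \<in> D then u x else v x)" for x
    have w1: "bij_betw w {b} {r}" by (simp add: w_def)
    have w2: "bij_betw w D ({..<p} - {r})"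
      using u by (rule bij_betw_cong[THEN iffD1, rotated]) (use bD in \<open>auto simp: w_def\<close>)
    have w3: "bij_betw w K {p..<2*p}"
      using v by (rule bij_betw_cong[THEN iffD1, rotated]) (auto simp: w_def K_def)
    have "bij_betw w ({b} \<union> D \<union> K) ({r} \<union> ({..<p} - {r}) \<union> {p..<2*p})"
      by (intro bij_betw_combine w1 w2 w3) (use rp in auto)
    moreover have "{b} \<union> D \<union> K = I" using b D C by (auto simp: K_def)
    moreover have "{r} \<union> ({..<p} - {r}) \<union> {p..<2*p} = {..<2*p}" using rp by auto
    ultimately have w: "bij_betw w I {..<2*p}" by simp
    have "(\<Sum>x\<in>I. int (w x) * a x) =
        (\<Sum>x\<in>K. int (w x) * a x) + (\<Sum>x\<in>insert b D. int (w x) * a x)"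
      unfolding K_def by (rule sum.subset_diff) (use b D C I in auto)
    also have "(\<Sum>x\<in>insert b D. int (w x) * a x) = int r * a b + (\<Sum>x\<in>D. int (w x) * a x)"
      using bD D by (simp add: w_def)
    also have "(\<Sum>x\<in>K. int (w x) * a x) = (\<Sum>x\<in>K. int (v x) * a x)"
      by (intro sum.cong) (auto simp: w_def K_def)
    finally have sum: "(\<Sum>x\<in>I. int (w x) * a x) =
        (\<Sum>x\<in>K. int (v x) * a x) + (int r * a b + (\<Sum>x\<in>D. int (w x) * a x))" .
    have "[(\<Sum>x\<in>D. int (w x) * a x) = (\<Sum>x\<in>D. int (w x) * c)] (mod int p)"
    proof (intro cong_sum cong_mult cong_refl)
      fix x assume "x \<in> D"
      then have "a x mod int p = c" using D C by blast
      then show "[a x = c] (mod int p)" by (auto simp: cong_def)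
    qed
    also have "(\<Sum>x\<in>D. int (w x) * c) = (\<Sum>k\<in>{..<p} - {r}. int k * c)"
      by (rule sum.reindex_bij_betw[OF w2, of "\<lambda>k. int k * c"])
    also have "\<dots> = c * (\<Sum>k<p. int k) - int r * c"
      using rp by (simp add: sum_diff1 sum_distrib_left mult.commute)
    finally have "[(\<Sum>x\<in>I. int (w x) * a x) =
        (\<Sum>x\<in>K. int (v x) * a x) + (int r * a b + (c * (\<Sum>k<p. int k) - int r * c))] (mod int p)"
      unfolding sum by (intro cong_add cong_refl)
    also have "(\<Sum>x\<in>K. int (v x) * a x) + (int r * a b + (c * (\<Sum>k<p. int k) - int r * c))
        = int r * (a b - c) + S"
      by (simp add: S_def algebra_simps)
    also have "[\<dots> = - S + S] (mod int p)" by (intro cong_add cong_refl rS)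
    finally show ?thesis using w by (auto simp: cong_0_iff)
  qed
next
  fix e assume e: "bij_betw e {..<2*p} I"
    and ne: "\<And>i. i < p \<Longrightarrow> a (e i) mod int p \<noteq> a (e (i + p)) mod int p"
  \<comment> \<open>Pair \<open>i\<close> initially carries the weights \<open>2 * i\<close> and
    \<open>2 * i + 1\<close>, which gives the total \<open>T\<close>; \<open>d i\<close> is the
    change when the two weights are exchanged.\<close>
  define d where "d i = a (e i) - a (e (i + p))" for i
  define T where "T = (\<Sum>i<p. 2 * int i * a (e i) + (2 * int i + 1) * a (e (i + p)))"
  obtain E where E: "E \<subseteq> {..<p}" "[sum d E = - T] (mod int p)"
    by (rule subset_sum_cong[OF p, of "{..<p}" d]) (use ne in \<open>auto simp: d_def mod_eq_dvd_iff\<close>)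
  \<comment> \<open>The weight of position \<open>k\<close> after exchanging exactly the pairs in
    \<open>E\<close>. For injectivity below, \<open>u k div 2\<close> recovers the pair and the
    parity of \<open>u k\<close> the member.\<close>
  define u where "u k = (if k < p then 2 * k + of_bool (k \<in> E)
      else 2 * (k - p) + (1 - of_bool (k - p \<in> E)))" for k
  have "inj_on u {..<2*p}"
  proof (rule inj_onI)
    fix k l assume kl: "k \<in> {..<2*p}" "l \<in> {..<2*p}" and eq: "u k = u l"
    have half: "u k div 2 = (if k < p then k else k - p)" for k by (auto simp: u_def)
    have par: "odd (u k) \<longleftrightarrow> (if k < p then k \<in> E else k - p \<notin> E)" for k by (auto simp: u_def)
    have "(if k < p then k else k - p) = (if l < p then l else l - p)" using half eq by metis
    moreover have "k < p \<longleftrightarrow> l < p" using calculation par[of k] par[of l] eq by (metis (no_types))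
    ultimately show "k = l" by (simp split: if_splits)
  qed
  moreover have "u ` {..<2*p} \<subseteq> {..<2*p}" by (auto simp: u_def)
  ultimately have u: "bij_betw u {..<2*p} {..<2*p}"
    by (simp add: bij_betw_def endo_inj_surj)
  define f where "f = inv_into {..<2*p} e"
  have f: "bij_betw f I {..<2*p}" unfolding f_def using e by (rule bij_betw_inv_into)
  have fe: "f (e k) = k" if "k < 2 * p" for k
    unfolding f_def using e that by (simp add: bij_betw_inv_into_left)
  have "(\<Sum>x\<in>I. int (u (f x)) * a x) = (\<Sum>k<2*p. int (u (f (e k))) * a (e k))"
    using sum.reindex_bij_betw[OF e, of "\<lambda>x. int (u (f x)) * a x"] by simp
  also have "\<dots> = (\<Sum>k<2*p. int (u k) * a (e k))" by (intro sum.cong) (auto simp: fe)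
  also have "\<dots> = (\<Sum>k<p. int (u k) * a (e k)) + (\<Sum>k<p. int (u (k + p)) * a (e (k + p)))"
    using sum.atLeastLessThan_concat[of 0 p "2*p" "\<lambda>k. int (u k) * a (e k)"]
      sum.shift_bounds_nat_ivl[of "\<lambda>k. int (u k) * a (e k)" 0 p p]
    by (simp add: lessThan_atLeast0 mult_2)
  also have "\<dots> = (\<Sum>k<p. (2 * int k * a (e k) + (2 * int k + 1) * a (e (k + p)))
      + (if k \<in> E then d k else 0))"
    unfolding sum.distrib[symmetric] by (intro sum.cong) (auto simp: u_def d_def algebra_simps)
  also have "\<dots> = T + sum d E"
    using E(1) by (simp add: sum.distrib sum.If_cases Int_absorb1 T_def)
  finally have "int p dvd (\<Sum>x\<in>I. int (u (f x)) * a x)"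
    using E(2) by (simp add: cong_iff_dvd_diff algebra_simps)
  moreover have "bij_betw (u \<circ> f) I {..<2*p}" using f u by (rule bij_betw_trans)
  ultimately show ?thesis by (intro exI[of _ "u \<circ> f"]) simp
qed

section \<open>Composite moduli\<close>

text \<open>The weight is \<open>h + q * v\<close>, where \<open>h\<close> is the label of the group
  modulo \<open>q\<close> and \<open>v\<close> the weight inside the merged group. The
  \<open>h\<close> part gains the factor \<open>p\<close> from the group sums and \<open>q\<close>
  from the labelling; in the other part \<open>q\<close> is explicit and \<open>p\<close> comes from
  \<open>prime_weighting\<close>.\<close>

lemma weighting_mult_prime:
  fixes p q :: nat and a :: "nat \<Rightarrow> int"
  assumes p: "prime p" and q: "q > 0"
    and IH: "\<And>t :: nat \<Rightarrow> int. int q dvd (\<Sum>j<2*q. t j) \<Longrightarrow>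
      \<exists>w. bij_betw w {..<2*q} {..<2*q} \<and> int q dvd (\<Sum>j<2*q. int (w j) * t j)"
    and I: "finite I" "card I = 2 * (p * q)" and dvd: "int (p * q) dvd sum a I"
  shows "\<exists>w. bij_betw w I {..<2*(p*q)} \<and> int (p * q) dvd (\<Sum>x\<in>I. int (w x) * a x)"
proof -
  have "card I = p * (2 * q)" "int p dvd sum a I" using I dvd by (auto elim: dvd_mult_left)
  from zero_sum_partition[OF p I(1) this] obtain g where
    g: "g ` I \<subseteq> {..<2*q}" "\<And>j. j < 2*q \<Longrightarrow> card {x \<in> I. g x = j} = p"
      "\<And>j. j < 2*q \<Longrightarrow> int p dvd sum a {x \<in> I. g x = j}"
    by blast
  define t where "t j = sum a {x \<in> I. g x = j} div int p" for j
  have t: "sum a {x \<in> I. g x = j} = int p * t j" if "j < 2*q" for j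
    using g(3)[OF that] by (simp add: t_def)
  \<comment> \<open>Weights depending only on the group reduce to a sum over groups. Constant weight
    1 gives the premise of \<open>IH\<close>; the labels modulo \<open>q\<close> give
    \<open>first\<close>.\<close>
  have fibres: "(\<Sum>x\<in>I. f (g x) * a x) = int p * (\<Sum>j<2*q. f j * t j)" for f :: "nat \<Rightarrow> int"
  proof -
    have "(\<Sum>x\<in>I. f (g x) * a x) = (\<Sum>j<2*q. \<Sum>x\<in>{x \<in> I. g x = j}. f (g x) * a x)"
      using sum.group[OF I(1) _ g(1), of "\<lambda>x. f (g x) * a x"] by simp
    also have "\<dots> = (\<Sum>j<2*q. f j * sum a {x \<in> I. g x = j})"
      by (simp add: sum_distrib_left)
    also have "\<dots> = (\<Sum>j<2*q. f j * (int p * t j))" by (intro sum.cong) (simp_all add: t)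
    finally show ?thesis by (simp add: sum_distrib_left algebra_simps)
  qed
  have "int q dvd (\<Sum>j<2*q. t j)"
    using dvd fibres[of "\<lambda>_. 1"] p by (simp add: prime_gt_0_nat)
  from IH[OF this] obtain l where l: "bij_betw l {..<2*q} {..<2*q}"
    "int q dvd (\<Sum>j<2*q. int (l j) * t j)" by blast
  define h where "h x = l (g x) mod q" for x
  have first: "int (p * q) dvd (\<Sum>x\<in>I. int (h x) * a x)"
  proof -
    have "[(\<Sum>j<2*q. int (l j mod q) * t j) = (\<Sum>j<2*q. int (l j) * t j)] (mod int q)"
      by (intro cong_sum cong_mult cong_refl) (simp add: cong_def zmod_int)
    then have "int q dvd (\<Sum>j<2*q. int (l j mod q) * t j)"
      using l(2) by (simp add: cong_dvd_iff)
    then show ?thesis using fibres[of "\<lambda>j. int (l j mod q)"] by (simp add: h_def)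
  qed
  \<comment> \<open>Exactly the labels \<open>r\<close> and \<open>r + q\<close> reduce to
    \<open>r\<close>, so two groups of size \<open>p\<close> are merged.\<close>
  have fibre_h: "card {x \<in> I. h x = r} = 2 * p" if r: "r < q" for r
  proof -
    define L where "L = inv_into {..<2*q} l"
    have L: "L k < 2*q" "l (L k) = k" if "k < 2*q" for k
      using that l(1) bij_betw_inv_into[OF l(1)] bij_betw_inv_into_right[OF l(1)]
      by (auto simp: L_def bij_betw_def)
    have Ll: "L (l j) = j" if "j < 2*q" for j
      using that l(1) by (simp add: L_def bij_betw_inv_into_left)
    have lt: "l j < 2*q" if "j < 2*q" for j using l(1) that by (auto simp: bij_betw_def)
    have "{x \<in> I. h x = r} = {x \<in> I. g x = L r} \<union> {x \<in> I. g x = L (r + q)}"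
    proof -
      have "h x = r \<longleftrightarrow> g x = L r \<or> g x = L (r + q)" if "x \<in> I" for x
      proof -
        have gx: "g x < 2*q" using g(1) that by auto
        have "l (g x) mod q = r \<longleftrightarrow> l (g x) = r \<or> l (g x) = r + q"
          using lt[OF gx] r by (auto simp: mod_if)
        also have "\<dots> \<longleftrightarrow> g x = L r \<or> g x = L (r + q)"
          using L[of r] L[of "r + q"] Ll[OF gx] r by auto
        finally show ?thesis by (simp add: h_def)
      qed
      then show ?thesis by blast
    qed
    moreover have "L r \<noteq> L (r + q)" using L(2)[of r] L(2)[of "r + q"] r q by fastforce
    ultimately show ?thesis
      using g(2) L(1)[of r] L(1)[of "r + q"] r I(1) by (simp add: card_Un_disjoint disjoint_iff)
  qed
  have "\<forall>r\<in>{..<q}. \<exists>w. bij_betw w {x \<in> I. h x = r} {..<2*p} \<and>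
      int p dvd (\<Sum>x\<in>{x \<in> I. h x = r}. int (w x) * a x)"
    by (intro ballI prime_weighting[OF p]) (use I fibre_h in auto)
  from bchoice[OF this] obtain v where v: "\<And>r. r < q \<Longrightarrow> bij_betw (v r) {x \<in> I. h x = r} {..<2*p}"
    "\<And>r. r < q \<Longrightarrow> int p dvd (\<Sum>x\<in>{x \<in> I. h x = r}. int (v r x) * a x)"
    by auto
  define w where "w x = h x + q * v (h x) x" for x
  have hq: "h x < q" for x using q by (simp add: h_def)
  have "inj_on w I"
  proof (rule inj_onI)
    fix x y assume xy: "x \<in> I" "y \<in> I" and eq: "w x = w y"
    \<comment> \<open>\<open>h\<close> and \<open>v\<close> are the remainder and quotient of
      \<open>w\<close> by \<open>q\<close>.\<close>
    have "w z mod q = h z" "w z div q = v (h z) z" for z using hq[of z] by (simp_all add: w_def)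
    then have "h x = h y" "v (h x) x = v (h x) y" using eq by metis+
    then show "x = y" using v(1)[OF hq[of x]] xy by (auto simp: bij_betw_def inj_on_def)
  qed
  moreover have "w ` I \<subseteq> {..<2*(p*q)}"
  proof clarsimp
    fix x assume "x \<in> I"
    then have "v (h x) x < 2 * p" using v(1)[OF hq[of x]] by (auto simp: bij_betw_def)
    then have "q * (v (h x) x + 1) \<le> q * (2 * p)" by (intro mult_left_mono) auto
    then show "w x < 2 * (p * q)" using hq[of x] by (simp add: w_def algebra_simps)
  qed
  ultimately have "bij_betw w I {..<2*(p*q)}"
    using I(2) by (simp add: bij_betw_def card_image card_subset_eq)
  moreover have "int (p * q) dvd (\<Sum>x\<in>I. int (w x) * a x)"
  proof -
    have "(\<Sum>x\<in>I. int (v (h x) x) * a x) = (\<Sum>r<q. \<Sum>x\<in>{x \<in> I. h x = r}. int (v (h x) x) * a x)"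
      by (rule sum.group[symmetric]) (use hq I in auto)
    also have "int p dvd \<dots>" by (rule dvd_sum) (use v(2) in simp)
    finally have "int (p * q) dvd int q * (\<Sum>x\<in>I. int (v (h x) x) * a x)" by (simp add: mult.commute)
    with first have "int (p * q) dvd (\<Sum>x\<in>I. int (h x) * a x) + int q * (\<Sum>x\<in>I. int (v (h x) x) * a x)"
      by (rule dvd_add)
    then show ?thesis by (simp add: w_def sum.distrib sum_distrib_left algebra_simps)
  qed
  ultimately show ?thesis by blast
qed

text \<open>Strong induction, removing one prime factor \<open>p\<close> of \<open>m\<close>. The
  induction hypothesis is applied to group sums on \<open>{..<2*q}\<close>, so \<open>I\<close> and
  \<open>a\<close> must vary.\<close>

lemma ex_weighting:
  fixes m :: nat and a :: "nat \<Rightarrow> int"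
  assumes "m > 0" "finite I" "card I = 2 * m" "int m dvd sum a I"
  shows "\<exists>w. bij_betw w I {..<2*m} \<and> int m dvd (\<Sum>x\<in>I. int (w x) * a x)"
  using assms
proof (induction m arbitrary: I a rule: less_induct)
  case (less m)
  show ?case
  proof (cases "m = 1")
    case True
    then show ?thesis using less.prems ex_bij_betw_finite_nat[of I] by (auto simp: atLeast0LessThan)
  next
    case False
    then obtain p where p: "prime p" "p dvd m" using prime_factor_nat by blast
    then obtain q where m: "m = p * q" by auto
    have q: "q > 0" "q < m" using less.prems(1) prime_gt_1_nat[OF p(1)] by (auto simp: m)
    show ?thesis unfolding m
      by (rule weighting_mult_prime[OF p(1) q(1)])
        (use less.IH[OF q(2,1), of "{..<2*q}"] less.prems m in auto)
  qed
qed

section \<open>From weightings to permutations and arithmetic progressions\<close>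

theorem theorem1p2:
  fixes n :: nat and a :: "nat \<Rightarrow> int"
  assumes "n > 0" and "even n"
    and "[(\<Sum>k=1..n. a k) = 0] (mod (int n))"
  shows "(\<exists>\<sigma>. \<sigma> permutes {1..n} \<and>
            [(\<Sum>k=1..n. int k * a (\<sigma> k)) = 0] (mod (int (n div 2)))) \<and>
         (\<forall>w :: nat \<Rightarrow> int. \<forall>d :: int.
            even d \<longrightarrow> (\<forall>k\<in>{1..<n}. w (k + 1) - w k = d) \<longrightarrow>
            (\<exists>\<sigma>. \<sigma> permutes {1..n} \<and>
              [(\<Sum>k=1..n. w k * a (\<sigma> k)) = 0] (mod (int n))))"
proof -
  define m where "m = n div 2"
  have n: "n = 2 * m" "m > 0" using assms by (auto simp: m_def)
  have sum_n: "int n dvd (\<Sum>k=1..n. a k)" using assms(3) by (simp add: cong_0_iff)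
  then have sum_m: "int m dvd (\<Sum>k=1..n. a k)" by (rule dvd_trans[rotated]) (simp add: n)
  from ex_weighting[OF n(2), of "{1..n}" a] obtain v where
    v: "bij_betw v {1..n} {..<n}" "int m dvd (\<Sum>x=1..n. int (v x) * a x)"
    using sum_m n by auto
  \<comment> \<open>Shifting the weights from \<open>0..<n\<close> to \<open>1..n\<close> adds
    \<open>a x\<close> for each \<open>x\<close>, a multiple of \<open>m\<close> in total.\<close>
  define \<pi> where "\<pi> x = (if x \<in> {1..n} then v x + 1 else x)" for x
  have "bij_betw Suc {..<n} {1..n}" by (simp add: bij_betw_def lessThan_atLeast0 image_Suc_atLeastLessThan
      atLeastLessThanSuc_atLeastAtMost)
  with v(1) have "bij_betw (Suc \<circ> v) {1..n} {1..n}" by (rule bij_betw_trans)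
  then have "bij_betw \<pi> {1..n} {1..n}"
    by (rule bij_betw_cong[THEN iffD1, rotated]) (auto simp: \<pi>_def)
  then have \<pi>: "\<pi> permutes {1..n}" by (rule bij_imp_permutes) (auto simp: \<pi>_def)
  \<comment> \<open>\<open>\<pi>\<close> sends an index to its weight, whereas the claim asks for
    the index placed at weight \<open>k\<close>.\<close>
  define \<sigma> where "\<sigma> = inv \<pi>"
  have \<sigma>: "\<sigma> permutes {1..n}" unfolding \<sigma>_def using \<pi> by (rule permutes_inv)
  have "(\<Sum>k=1..n. int k * a (\<sigma> k)) = (\<Sum>x=1..n. int (\<pi> x) * a (\<sigma> (\<pi> x)))"
    using sum.permute[OF \<pi>, of "\<lambda>k. int k * a (\<sigma> k)"] by (simp add: o_def)
  also have "\<dots> = (\<Sum>x=1..n. int (v x) * a x + a x)"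
  proof (intro sum.cong refl)
    fix x assume "x \<in> {1..n}"
    then have "\<pi> x = v x + 1" by (simp add: \<pi>_def)
    moreover have "\<sigma> (\<pi> x) = x" by (simp add: \<sigma>_def permutes_inverses[OF \<pi>])
    ultimately show "int (\<pi> x) * a (\<sigma> (\<pi> x)) = int (v x) * a x + a x" by (simp add: algebra_simps)
  qed
  finally have main: "int m dvd (\<Sum>k=1..n. int k * a (\<sigma> k))"
    using v(2) sum_m by (simp add: sum.distrib)
  have "[(\<Sum>k=1..n. w k * a (\<sigma> k)) = 0] (mod int n)"
    if d: "even d" and w: "\<forall>k\<in>{1..<n}. w (k + 1) - w k = d" for w :: "nat \<Rightarrow> int" and d
  proof -
    have w_eq: "w k = w 1 - d + d * int k" if "1 \<le> k" "k \<le> n" for k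
      using that
    proof (induction k rule: dec_induct)
      case (step k)
      have "k \<in> {1..<n}" using step by simp
      then have "w (Suc k) = w k + d" using w by (simp add: diff_eq_eq add.commute)
      moreover have "w k = w 1 - d + d * int k" using step by simp
      ultimately show ?case by (simp add: algebra_simps)
    qed simp
    have "(\<Sum>k=1..n. w k * a (\<sigma> k)) = (\<Sum>k=1..n. (w 1 - d) * a (\<sigma> k) + d * (int k * a (\<sigma> k)))"
      by (intro sum.cong refl) (subst w_eq, auto simp: algebra_simps)
    also have "\<dots> = (w 1 - d) * (\<Sum>k=1..n. a (\<sigma> k)) + d * (\<Sum>k=1..n. int k * a (\<sigma> k))"
      by (simp add: sum.distrib sum_distrib_left)
    also have "(\<Sum>k=1..n. a (\<sigma> k)) = (\<Sum>k=1..n. a k)"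
      using sum.permute[OF \<sigma>, of a] by (simp add: o_def)
    finally have "(\<Sum>k=1..n. w k * a (\<sigma> k)) =
      (w 1 - d) * (\<Sum>k=1..n. a k) + d * (\<Sum>k=1..n. int k * a (\<sigma> k))" .
    \<comment> \<open>The even difference \<open>d\<close> supplies the factor 2 that lifts
      divisibility from \<open>m\<close> to \<open>n\<close>.\<close>
    moreover have "int n dvd d * (\<Sum>k=1..n. int k * a (\<sigma> k))"
      using mult_dvd_mono[OF d main] by (simp add: n)
    ultimately show ?thesis using sum_n by (simp add: cong_0_iff)
  qed
  then show ?thesis using \<sigma> main by (auto simp: cong_0_iff m_def)
qed

end
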